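(* Let $A,B\in\mathbb{C}^{n\times n}$ with $A^{\mathsf H}=A$ and $B^{\mathsf T}=B$, and let $H=\begin{bmatrix}A&B\\ -\overline{B}&-\overline{A}\end{bmatrix}\in\mathbb{C}^{2n\times 2n}$. Let $\alpha\in\mathbb{R}$ be such that both $\alpha I_n-A$ and $R\equiv I_n-(\alpha I_n-\overline{A})^{-1}\overline{B}(\alpha I_n-A)^{-1}B$ are nonsingular. Then there exists a nonsingular matrix $G\in\mathbb{C}^{2n\times 2n}$ such that $(G(H+\alpha I_{2n}),\,G(H-\alpha I_{2n}))$ is a symplectic pair in SSF-1, with $$G(H+\alpha I_{2n})=\begin{bmatrix}E_\alpha&0\\ F_\alpha&I_n\end{bmatrix},\qquad G(H-\alpha I_{2n})=\begin{bmatrix}I_n&\overline{F}_\alpha\\ 0&\overline{E}_\alpha\end{bmatrix},$$ where $E_\alpha,F_\alpha\in\mathbb{C}^{n\times n}$ satisfy $E_\alpha^{\mathsf H}=E_\alpha$ and $F_\alpha^{\mathsf T}=F_\alpha$.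
   Context: $(\cdot)^{\mathsf H}$, $(\cdot)^{\mathsf T}$ and $\overline{(\cdot)}$ denote conjugate transpose, transpose and entrywise complex conjugate. Let $J=\begin{bmatrix}0&I_n\\ -I_n&0\end{bmatrix}$. A pair $(M,L)$ with $M,L\in\mathbb{C}^{2n\times2n}$ is a symplectic pair if $MJM^{\mathsf T}=LJL^{\mathsf T}$. It is in the first standard symplectic form (SSF-1) if $M=\begin{bmatrix}E&0\\ F&I_n\end{bmatrix}$ and $L=\begin{bmatrix}I_n&K\\ 0&E^{\mathsf T}\end{bmatrix}$ with $E,F,K\in\mathbb{C}^{n\times n}$, $F=F^{\mathsf T}$, $K=K^{\mathsf T}$. *)

theory Defs
  imports
    "Jordan_Normal_Form.Gauss_Jordan_Elimination"
    "Jordan_Normal_Form.Schur_Decomposition"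
begin

definition J_mat :: "nat \<Rightarrow> complex mat" where
  "J_mat n = four_block_mat (0\<^sub>m n n) (1\<^sub>m n) (- 1\<^sub>m n) (0\<^sub>m n n)"

definition symplectic_pair :: "nat \<Rightarrow> complex mat \<Rightarrow> complex mat \<Rightarrow> bool" where
  "symplectic_pair n M L \<longleftrightarrow>
     M \<in> carrier_mat (2 * n) (2 * n) \<and> L \<in> carrier_mat (2 * n) (2 * n) \<and>
     M * J_mat n * transpose_mat M = L * J_mat n * transpose_mat L"

text \<open>First standard symplectic form (SSF-1).\<close>

definition SSF1 :: "nat \<Rightarrow> complex mat \<Rightarrow> complex mat \<Rightarrow> bool" where
  "SSF1 n M L \<longleftrightarrow>
     (\<exists>E F K. E \<in> carrier_mat n n \<and> F \<in> carrier_mat n n \<and> K \<in> carrier_mat n n \<and>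
        transpose_mat F = F \<and> transpose_mat K = K \<and>
        M = four_block_mat E (0\<^sub>m n n) F (1\<^sub>m n) \<and>
        L = four_block_mat (1\<^sub>m n) K (0\<^sub>m n n) (transpose_mat E))"

text \<open>The library function \<open>mat_inverse\<close> returns an option; \<open>mat_inv\<close> is only
  meaningful for nonsingular square matrices.\<close>

definition mat_inv :: "complex mat \<Rightarrow> complex mat" where
  "mat_inv X = the (mat_inverse X)"

end

theory Submission
  imports Defs
begin

text \<open>
  Write \<open>P = \<alpha> I - A\<close>, which is Hermitian. The two prescribed block columns of the pair
  (the second one of \<open>G (H + \<alpha> I)\<close> and the first one of \<open>G (H - \<alpha> I)\<close>) say exactly that
  \<open>G W = I\<close> for the matrix \<open>W = [[-P, B], [-cnj B, cnj P]]\<close> assembled from the second block column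
  of \<open>H + \<alpha> I\<close> and the first block column of \<open>H - \<alpha> I\<close>. So \<open>G\<close> has to be the inverse of \<open>W\<close>, and it
  exists because the Schur complement of \<open>-P\<close> in \<open>W\<close> is \<open>cnj P * R\<close>
  (\<open>det_four_block_mat_Schur\<close>).

  The remaining blocks follow from \<open>H + \<alpha> I = W + diag (2 \<alpha> I, 0)\<close> and
  \<open>H - \<alpha> I = W - diag (0, 2 \<alpha> I)\<close>: if \<open>G = [[G1, G2], [G3, G4]]\<close>, they are
  \<open>I + 2 \<alpha> G1\<close> and \<open>2 \<alpha> G3\<close>, respectively \<open>-2 \<alpha> G2\<close> and \<open>I - 2 \<alpha> G4\<close>. They have the required
  form thanks to two symmetries of \<open>W\<close>, both of which pass to the inverse
  (\<open>inverse_intertwines\<close>, \<open>blocks_of_inverse\<close>): exchanging the two block rows and the two block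
  columns turns \<open>W\<close> into \<open>- cnj W\<close>, so that \<open>G4 = - cnj G1\<close> and \<open>G2 = - cnj G3\<close>; and changing the
  sign of the off-diagonal blocks turns \<open>W\<close> into its adjoint, so that \<open>G1\<close> is Hermitian and
  \<open>G2\<close> is minus the adjoint of \<open>G3\<close>, whence \<open>G3\<close> is symmetric.

  Finally, every pair in SSF-1 is symplectic by a block computation (\<open>SSF1_symplectic_pair\<close>).
\<close>

section \<open>Inverses and block matrices\<close>

lemma mat_inv_inverse:
  assumes X: "X \<in> carrier_mat n n" and inv: "invertible_mat X"
  shows "mat_inv X \<in> carrier_mat n n" "X * mat_inv X = 1\<^sub>m n" "mat_inv X * X = 1\<^sub>m n"
proof -
  obtain Y where Y: "inverts_mat X Y" "inverts_mat Y X"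
    using inv unfolding invertible_mat_def by blast
  have XY: "X * Y = 1\<^sub>m n" using Y(1) X unfolding inverts_mat_def by simp
  have Yr: "dim_row Y = n"
    using Y(2) X unfolding inverts_mat_def
    by (metis carrier_matD(2) index_mult_mat(3) index_one_mat(3))
  have Yc: "dim_col Y = n" using XY by (metis index_mult_mat(3) index_one_mat(3))
  have YX: "Y * X = 1\<^sub>m n" using Y(2) Yr unfolding inverts_mat_def by simp
  have "X \<in> Units (ring_mat TYPE(complex) n ())"
    using X XY YX Yr Yc unfolding Units_def ring_mat_def by auto
  then obtain Z where "mat_inverse X = Some Z"
    using mat_inverse(1)[OF X, where b = "()"] by (cases "mat_inverse X") auto
  then show "mat_inv X \<in> carrier_mat n n" "X * mat_inv X = 1\<^sub>m n" "mat_inv X * X = 1\<^sub>m n"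
    using mat_inverse(2)[OF X] unfolding mat_inv_def by auto
qed

lemma invertible_mat_if_right_inverse:
  fixes X :: "'a :: field mat"
  assumes "X \<in> carrier_mat n n" "Y \<in> carrier_mat n n" "X * Y = 1\<^sub>m n"
  shows "invertible_mat X"
  using assms mat_mult_left_right_inverse[OF assms]
  unfolding invertible_mat_def inverts_mat_def by (intro conjI exI[of _ Y]) auto

lemma det_nonzero_obtain_inverse:
  fixes X :: "'a :: field mat"
  assumes X: "X \<in> carrier_mat n n" and "det X \<noteq> 0"
  obtains Y where "Y \<in> carrier_mat n n" "X * Y = 1\<^sub>m n" "Y * X = 1\<^sub>m n"
  using det_non_zero_imp_unit[OF assms, of "()"]
  unfolding Units_def ring_mat_def by auto

lemma det_nonzero_if_right_inverse:
  fixes X :: "'a :: field mat"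
  assumes "X \<in> carrier_mat n n" "Y \<in> carrier_mat n n" "X * Y = 1\<^sub>m n"
  shows "det X \<noteq> 0"
  using det_mult[OF assms(1,2)] assms(3) by auto

text \<open>Block elimination: the matrix is the product of
  \<open>[[A, 0], [C, D - C A' B]]\<close> and \<open>[[I, A' B], [0, I]]\<close>.\<close>

lemma det_four_block_mat_Schur:
  fixes A :: "'a :: field mat"
  assumes A: "A \<in> carrier_mat n n" and B: "B \<in> carrier_mat n m"
    and C: "C \<in> carrier_mat m n" and D: "D \<in> carrier_mat m m"
    and A': "A' \<in> carrier_mat n n" and AA': "A * A' = 1\<^sub>m n"
  shows "det (four_block_mat A B C D) = det A * det (D - C * A' * B)"
proof -
  define S where "S = D - C * A' * B"
  have S: "S \<in> carrier_mat m m" using A' B C D unfolding S_def by auto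
  have "A * (A' * B) = B" using A A' B AA' by (simp add: assoc_mult_mat[symmetric])
  moreover have "C * (A' * B) + S = D"
    using A' B C D unfolding S_def by (intro eq_matI) (auto simp: assoc_mult_mat[of C m n A' n B m])
  ultimately have "four_block_mat A B C D =
      four_block_mat A (0\<^sub>m n m) C S * four_block_mat (1\<^sub>m n) (A' * B) (0\<^sub>m m n) (1\<^sub>m m)"
    using A B C D A' S
    by (subst mult_four_block_mat[of _ n n _ m _ m _ _ n _ m]) auto
  moreover have "det (four_block_mat A (0\<^sub>m n m) C S) = det A * det S"
    by (rule det_four_block_mat_upper_right_zero[OF A refl C S])
  moreover have "det (four_block_mat (1\<^sub>m n) (A' * B) (0\<^sub>m m n) (1\<^sub>m m :: 'a mat)) = 1"
    using A' B by (subst det_four_block_mat_lower_left_zero) auto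
  moreover have "det (four_block_mat A (0\<^sub>m n m) C S *
        four_block_mat (1\<^sub>m n) (A' * B) (0\<^sub>m m n) (1\<^sub>m m)) =
      det (four_block_mat A (0\<^sub>m n m) C S) *
        det (four_block_mat (1\<^sub>m n) (A' * B) (0\<^sub>m m n) (1\<^sub>m m))"
    using A S by (intro det_mult[of _ "n + m"]) auto
  ultimately show ?thesis unfolding S_def by simp
qed

lemma four_block_mat_inject:
  assumes eq: "four_block_mat A B C D = four_block_mat A' B' C' D'"
    and "A \<in> carrier_mat nr1 nc1" "B \<in> carrier_mat nr1 nc2"
      "C \<in> carrier_mat nr2 nc1" "D \<in> carrier_mat nr2 nc2"
    and "A' \<in> carrier_mat nr1 nc1" "B' \<in> carrier_mat nr1 nc2"
      "C' \<in> carrier_mat nr2 nc1" "D' \<in> carrier_mat nr2 nc2"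
  shows "A = A'" "B = B'" "C = C'" "D = D'"
proof -
  have ix: "four_block_mat A B C D $$ (i, j) = four_block_mat A' B' C' D' $$ (i, j)" for i j
    using eq by simp
  show "A = A'"
  proof (rule eq_matI)
    fix i j assume "i < dim_row A'" "j < dim_col A'"
    then show "A $$ (i, j) = A' $$ (i, j)" using ix[of i j] assms(2-) by auto
  qed (use assms in auto)
  show "B = B'"
  proof (rule eq_matI)
    fix i j assume "i < dim_row B'" "j < dim_col B'"
    then show "B $$ (i, j) = B' $$ (i, j)" using ix[of i "nc1 + j"] assms(2-) by auto
  qed (use assms in auto)
  show "C = C'"
  proof (rule eq_matI)
    fix i j assume "i < dim_row C'" "j < dim_col C'"
    then show "C $$ (i, j) = C' $$ (i, j)" using ix[of "nr1 + i" j] assms(2-) by auto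
  qed (use assms in auto)
  show "D = D'"
  proof (rule eq_matI)
    fix i j assume "i < dim_row D'" "j < dim_col D'"
    then show "D $$ (i, j) = D' $$ (i, j)" using ix[of "nr1 + i" "nc1 + j"] assms(2-) by auto
  qed (use assms in auto)
qed

text \<open>Multiplying \<open>T W = W' T\<close> by the inverse \<open>G'\<close> of \<open>W'\<close> from the left and by the inverse \<open>G\<close> of
  \<open>W\<close> from the right moves the symmetry \<open>T\<close> from \<open>W\<close> to \<open>G\<close>.\<close>

lemma inverse_intertwines:
  fixes T :: "'a :: field mat"
  assumes T: "T \<in> carrier_mat n n"
    and W: "W \<in> carrier_mat n n" and G: "G \<in> carrier_mat n n" and WG: "W * G = 1\<^sub>m n"
    and W': "W' \<in> carrier_mat n n" and G': "G' \<in> carrier_mat n n" and GW': "G' * W' = 1\<^sub>m n"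
    and TW: "T * W = W' * T"
  shows "T * G = G' * T"
proof -
  have "T * G = (G' * W') * (T * G)" using GW' T G by simp
  also have "\<dots> = G' * ((W' * T) * G)"
    using T G W' G' by (simp add: assoc_mult_mat[of _ n n _ n _ n])
  also have "\<dots> = G' * (T * (W * G))"
    using T G W by (simp flip: TW add: assoc_mult_mat[of _ n n _ n _ n])
  also have "\<dots> = G' * T" using WG T by simp
  finally show ?thesis .
qed

section \<open>Entrywise conjugate and adjoint\<close>

lemma map_mat_cnj_mult:
  assumes "X \<in> carrier_mat nr n" "Y \<in> carrier_mat n nc"
  shows "map_mat cnj (X * Y) = map_mat cnj X * map_mat cnj Y"
proof -
  interpret semiring_hom cnj by unfold_locales auto
  show ?thesis by (rule mat_hom_mult[OF assms])
qed

lemma map_mat_cnj_one [simp]: "map_mat cnj (1\<^sub>m n) = 1\<^sub>m n"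
  by (intro eq_matI) auto

lemma map_mat_cnj_cnj [simp]: "map_mat cnj (map_mat cnj X) = X"
  by (intro eq_matI) auto

lemma mat_adjoint_conv: "mat_adjoint X = map_mat cnj (transpose_mat X)"
  unfolding mat_adjoint_def by (intro eq_matI) (auto simp: mat_of_rows_def)

lemma mat_adjoint_mult:
  fixes X Y :: "complex mat"
  assumes "X \<in> carrier_mat nr n" "Y \<in> carrier_mat n nc"
  shows "mat_adjoint (X * Y) = mat_adjoint Y * mat_adjoint X"
  unfolding mat_adjoint_conv transpose_mult[OF assms]
  using assms by (intro map_mat_cnj_mult) auto

section \<open>Symmetries of the inverse\<close>

text \<open>Two involutions express the structure of \<open>W\<close>: \<open>S = [[0, I], [I, 0]]\<close>, with
  \<open>S W = (- cnj W) S\<close>, and \<open>D = diag (I, -I)\<close>, with \<open>D W = W\<^sup>H D\<close>; the latter uses that \<open>P\<close> is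
  Hermitian and \<open>B\<close> symmetric. The inverse satisfies the same two relations, and comparing
  blocks in \<open>S G = (- cnj G) S\<close> and \<open>D G = G\<^sup>H D\<close> gives the conclusions.\<close>

lemma blocks_of_inverse:
  fixes P B :: "complex mat"
  assumes P: "P \<in> carrier_mat n n" and B: "B \<in> carrier_mat n n"
    and Ph: "mat_adjoint P = P" and Bs: "transpose_mat B = B"
    and W_def: "W = four_block_mat (- P) B (- map_mat cnj B) (map_mat cnj P)"
    and G1: "G1 \<in> carrier_mat n n" and G2: "G2 \<in> carrier_mat n n"
    and G3: "G3 \<in> carrier_mat n n" and G4: "G4 \<in> carrier_mat n n"
    and G_def: "G = four_block_mat G1 G2 G3 G4"
    and WG: "W * G = 1\<^sub>m (n + n)" and GW: "G * W = 1\<^sub>m (n + n)"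
  shows "G4 = - map_mat cnj G1" "G2 = - map_mat cnj G3"
    "mat_adjoint G1 = G1" "transpose_mat G3 = G3"
proof -
  note carr = P B G1 G2 G3 G4
  have W: "W \<in> carrier_mat (n + n) (n + n)" and G: "G \<in> carrier_mat (n + n) (n + n)"
    unfolding W_def G_def using carr by auto
  define S :: "complex mat" where "S = four_block_mat (0\<^sub>m n n) (1\<^sub>m n) (1\<^sub>m n) (0\<^sub>m n n)"
  define D :: "complex mat" where "D = four_block_mat (1\<^sub>m n) (0\<^sub>m n n) (0\<^sub>m n n) (- 1\<^sub>m n)"
  have S: "S \<in> carrier_mat (n + n) (n + n)" and D: "D \<in> carrier_mat (n + n) (n + n)"
    unfolding S_def D_def by auto
  have S_mult: "S * four_block_mat X1 X2 X3 X4 = four_block_mat X3 X4 X1 X2"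
    and mult_S: "four_block_mat X1 X2 X3 X4 * S = four_block_mat X2 X1 X4 X3"
    and D_mult: "D * four_block_mat X1 X2 X3 X4 = four_block_mat X1 X2 (- X3) (- X4)"
    and mult_D: "four_block_mat X1 X2 X3 X4 * D = four_block_mat X1 (- X2) X3 (- X4)"
    if "X1 \<in> carrier_mat n n" "X2 \<in> carrier_mat n n" "X3 \<in> carrier_mat n n" "X4 \<in> carrier_mat n n"
    for X1 X2 X3 X4
    unfolding S_def D_def using that
    by (subst mult_four_block_mat[of _ n n _ n _ n _ _ n _ n]; auto)+

  define W' where "W' = four_block_mat (map_mat cnj P) (- map_mat cnj B) B (- P)"
  define G' where "G' = four_block_mat (- map_mat cnj G1) (- map_mat cnj G2) (- map_mat cnj G3) (- map_mat cnj G4)"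
  have W': "W' = - map_mat cnj W" and G': "G' = - map_mat cnj G"
    unfolding W'_def W_def G'_def G_def using carr by (auto intro!: eq_matI)
  have "G' * W' = map_mat cnj (G * W)"
    unfolding W' G' using map_mat_cnj_mult[OF G W] G W by auto
  then have GW': "G' * W' = 1\<^sub>m (n + n)" using GW by simp
  have "S * W = W' * S"
    unfolding W_def W'_def using carr by (simp add: S_mult mult_S)
  then have "S * G = G' * S"
    using inverse_intertwines[OF S W G WG _ _ GW'] W G unfolding W' G' by auto
  then have "four_block_mat G3 G4 G1 G2 = four_block_mat (- map_mat cnj G2) (- map_mat cnj G1)
      (- map_mat cnj G4) (- map_mat cnj G3)"
    unfolding G_def G'_def using carr by (simp add: S_mult mult_S)
  from four_block_mat_inject[OF this, of n n n n] carr
  show G4_eq: "G4 = - map_mat cnj G1" and G2_eq: "G2 = - map_mat cnj G3" by auto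

  have WH: "mat_adjoint W = four_block_mat (- P) (- B) (map_mat cnj B) (map_mat cnj P)"
  proof -
    have "map_mat cnj (transpose_mat P) = P" using Ph unfolding mat_adjoint_conv .
    then have "transpose_mat P = map_mat cnj P" by (metis map_mat_cnj_cnj)
    moreover have "transpose_mat (- X) = - transpose_mat X" "map_mat cnj (- X) = - map_mat cnj X"
      "transpose_mat (map_mat cnj X) = map_mat cnj (transpose_mat X)" for X
      by (auto intro!: eq_matI)
    ultimately show ?thesis
      unfolding mat_adjoint_conv W_def using P B Bs
      by (subst transpose_four_block_mat[of _ n n _ n _ n]) auto
  qed
  have GH: "mat_adjoint G = four_block_mat (mat_adjoint G1) (mat_adjoint G3)
      (mat_adjoint G2) (mat_adjoint G4)"
    unfolding mat_adjoint_conv G_def using carr by (auto intro!: eq_matI)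
  have adj_carr: "mat_adjoint X \<in> carrier_mat k k" if "X \<in> carrier_mat k k" for X :: "complex mat" and k
    using that unfolding mat_adjoint_conv by auto
  have "mat_adjoint G * mat_adjoint W = 1\<^sub>m (n + n)"
    using WG mat_adjoint_mult[OF W G] by (simp add: mat_adjoint_conv)
  moreover have "D * W = mat_adjoint W * D"
    unfolding WH unfolding W_def using carr by (simp add: D_mult mult_D)
  ultimately have "D * G = mat_adjoint G * D"
    using inverse_intertwines[OF D W G WG] adj_carr[OF W] adj_carr[OF G] by blast
  then have "four_block_mat G1 G2 (- G3) (- G4) = four_block_mat (mat_adjoint G1) (- mat_adjoint G3)
      (mat_adjoint G2) (- mat_adjoint G4)"
    unfolding GH unfolding G_def using carr adj_carr by (simp add: D_mult mult_D)
  from four_block_mat_inject(1,2)[OF this, of n n n n] carr adj_carr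
  have "G1 = mat_adjoint G1" and "G2 = - mat_adjoint G3" by auto
  then show "mat_adjoint G1 = G1" by simp
  have "mat_adjoint G3 = map_mat cnj G3"
    using \<open>G2 = - mat_adjoint G3\<close> G2_eq by (metis uminus_uminus_mat)
  then show "transpose_mat G3 = G3"
    unfolding mat_adjoint_conv by (metis map_mat_cnj_cnj)
qed

section \<open>The standard symplectic form\<close>

text \<open>Both \<open>M J M\<^sup>T\<close> and \<open>L J L\<^sup>T\<close> equal \<open>[[0, E], [-E\<^sup>T, 0]]\<close>: the symmetry of \<open>F\<close> and \<open>K\<close> cancels
  the only diagonal blocks that could survive, \<open>F - F\<^sup>T\<close> and \<open>K\<^sup>T - K\<close>.\<close>

lemma SSF1_symplectic_pair:
  assumes "SSF1 n M L"
  shows "symplectic_pair n M L"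
proof -
  obtain E F K where E: "E \<in> carrier_mat n n" and F: "F \<in> carrier_mat n n"
    and K: "K \<in> carrier_mat n n"
    and Ft: "transpose_mat F = F" and Kt: "transpose_mat K = K"
    and M: "M = four_block_mat E (0\<^sub>m n n) F (1\<^sub>m n)"
    and L: "L = four_block_mat (1\<^sub>m n) K (0\<^sub>m n n) (transpose_mat E)"
    using assms unfolding SSF1_def by blast
  have "M * J_mat n = four_block_mat (0\<^sub>m n n) E (- 1\<^sub>m n) F"
    unfolding M J_mat_def using E F
    by (subst mult_four_block_mat[of _ n n _ n _ n _ _ n _ n]) auto
  moreover have "transpose_mat M = four_block_mat (transpose_mat E) F (0\<^sub>m n n) (1\<^sub>m n)"
    unfolding M using E F Ft by (subst transpose_four_block_mat[of _ n n _ n _ n]) auto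
  moreover have "- F + F = 0\<^sub>m n n" and "- K + K = 0\<^sub>m n n" using F K by auto
  ultimately have MJM: "M * J_mat n * transpose_mat M =
      four_block_mat (0\<^sub>m n n) E (- transpose_mat E) (0\<^sub>m n n)"
    using E F by (simp, subst mult_four_block_mat[of _ n n _ n _ n _ _ n _ n]) auto
  have "L * J_mat n = four_block_mat (- K) (1\<^sub>m n) (- transpose_mat E) (0\<^sub>m n n)"
    unfolding L J_mat_def using E K
    by (subst mult_four_block_mat[of _ n n _ n _ n _ _ n _ n]) auto
  moreover have "transpose_mat L = four_block_mat (1\<^sub>m n) (0\<^sub>m n n) K E"
    unfolding L using E K Kt by (subst transpose_four_block_mat[of _ n n _ n _ n]) auto
  ultimately have "L * J_mat n * transpose_mat L =
      four_block_mat (0\<^sub>m n n) E (- transpose_mat E) (0\<^sub>m n n)"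
    using E K \<open>- K + K = 0\<^sub>m n n\<close>
    by (simp, subst mult_four_block_mat[of _ n n _ n _ n _ _ n _ n]) auto
  with MJM show ?thesis
    unfolding symplectic_pair_def M L using E F K by (auto simp: mult_2)
qed

section \<open>Reduction of the shifted pair to standard form\<close>

theorem theorem3p2:
  fixes n :: nat and A B H R :: "complex mat" and \<alpha> :: real
  assumes "A \<in> carrier_mat n n" and "B \<in> carrier_mat n n"
    and "mat_adjoint A = A" and "transpose_mat B = B"
    and "H = four_block_mat A B (- map_mat cnj B) (- map_mat cnj A)"
    and "R = 1\<^sub>m n -
           mat_inv (complex_of_real \<alpha> \<cdot>\<^sub>m 1\<^sub>m n - map_mat cnj A) * map_mat cnj B *
           mat_inv (complex_of_real \<alpha> \<cdot>\<^sub>m 1\<^sub>m n - A) * B"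
    and "invertible_mat (complex_of_real \<alpha> \<cdot>\<^sub>m 1\<^sub>m n - A)"
    and "invertible_mat R"
  shows "\<exists>G E F. G \<in> carrier_mat (2 * n) (2 * n) \<and> invertible_mat G \<and>
           E \<in> carrier_mat n n \<and> F \<in> carrier_mat n n \<and>
           symplectic_pair n
             (G * (H + complex_of_real \<alpha> \<cdot>\<^sub>m 1\<^sub>m (2 * n)))
             (G * (H - complex_of_real \<alpha> \<cdot>\<^sub>m 1\<^sub>m (2 * n))) \<and>
           SSF1 n
             (G * (H + complex_of_real \<alpha> \<cdot>\<^sub>m 1\<^sub>m (2 * n)))
             (G * (H - complex_of_real \<alpha> \<cdot>\<^sub>m 1\<^sub>m (2 * n))) \<and>
           G * (H + complex_of_real \<alpha> \<cdot>\<^sub>m 1\<^sub>m (2 * n)) =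
             four_block_mat E (0\<^sub>m n n) F (1\<^sub>m n) \<and>
           G * (H - complex_of_real \<alpha> \<cdot>\<^sub>m 1\<^sub>m (2 * n)) =
             four_block_mat (1\<^sub>m n) (map_mat cnj F) (0\<^sub>m n n) (map_mat cnj E) \<and>
           mat_adjoint E = E \<and> transpose_mat F = F"
proof -
  note A = assms(1) and B = assms(2)
  define P where "P = complex_of_real \<alpha> \<cdot>\<^sub>m 1\<^sub>m n - A"
  have P: "P \<in> carrier_mat n n" using A unfolding P_def by (auto simp: minus_carrier_mat)
  have Q_eq: "complex_of_real \<alpha> \<cdot>\<^sub>m 1\<^sub>m n - map_mat cnj A = map_mat cnj P"
    unfolding P_def using A by (intro eq_matI) auto
  have Ph: "mat_adjoint P = P"
  proof (rule eq_matI)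
    fix i j assume ij: "i < dim_row P" "j < dim_col P"
    then have "mat_adjoint A $$ (i, j) = A $$ (i, j)" using assms(3) by simp
    with ij show "mat_adjoint P $$ (i, j) = P $$ (i, j)"
      using A P unfolding mat_adjoint_conv P_def by auto
  qed (use P in \<open>auto simp: mat_adjoint_conv\<close>)

  define P' where "P' = mat_inv P"
  have P': "P' \<in> carrier_mat n n" and PP': "P * P' = 1\<^sub>m n"
    using mat_inv_inverse[OF P] assms(7) unfolding P'_def P_def by auto
  have Q: "map_mat cnj P \<in> carrier_mat n n" using P by auto
  have QQ': "map_mat cnj P * map_mat cnj P' = 1\<^sub>m n"
    using map_mat_cnj_mult[OF P P'] PP' by simp
  have "invertible_mat (map_mat cnj P)"
    using invertible_mat_if_right_inverse[OF Q _ QQ'] P' by simp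
  note Qinv = mat_inv_inverse[OF Q this]
  define Q' where "Q' = mat_inv (map_mat cnj P)"
  have Q': "Q' \<in> carrier_mat n n" and QQ'1: "map_mat cnj P * Q' = 1\<^sub>m n"
    using Qinv unfolding Q'_def by auto
  have Bc: "map_mat cnj B \<in> carrier_mat n n" using B by auto
  have R_eq: "R = 1\<^sub>m n - Q' * map_mat cnj B * P' * B"
    using assms(6) unfolding Q_eq P_def[symmetric] P'_def Q'_def .
  have R: "R \<in> carrier_mat n n" unfolding R_eq using Q' Bc P' B by (auto simp: minus_carrier_mat)

  define W where "W = four_block_mat (- P) B (- map_mat cnj B) (map_mat cnj P)"
  have W: "W \<in> carrier_mat (n + n) (n + n)" unfolding W_def using P B by auto
  \<comment> \<open>The Schur complement of \<open>-P\<close>; its invertibility is the hypothesis on \<open>R\<close>.\<close>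
  have "map_mat cnj P - (- map_mat cnj B) * (- P') * B = map_mat cnj P * R"
  proof -
    have "map_mat cnj P * (Q' * map_mat cnj B * P' * B) = map_mat cnj P * Q' * map_mat cnj B * P' * B"
      using Q Q' Bc P' B by (simp add: assoc_mult_mat[of _ n n _ n _ n])
    also have "\<dots> = map_mat cnj B * P' * B" using QQ'1 Bc by simp
    finally have "map_mat cnj P * R = map_mat cnj P - map_mat cnj B * P' * B"
      unfolding R_eq using Q Q' Bc P' B by (subst mult_minus_distrib_mat[of _ n n _ n]) auto
    then show ?thesis using Bc P' by simp
  qed
  moreover have "- P * - P' = 1\<^sub>m n" using P P' PP' by simp
  ultimately have "det W = det (- P) * (det (map_mat cnj P) * det R)"
    unfolding W_def using P B Bc Q P'
    by (subst det_four_block_mat_Schur[where A' = "- P'"]) (auto simp: det_mult[OF Q R])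
  moreover have "det (- P) \<noteq> 0"
    using det_nonzero_if_right_inverse[of "- P" n "- P'"] P P' \<open>- P * - P' = 1\<^sub>m n\<close> by auto
  moreover have "det (map_mat cnj P) \<noteq> 0" using det_nonzero_if_right_inverse[OF Q Q' QQ'1] .
  moreover have "det R \<noteq> 0"
    using det_nonzero_if_right_inverse[OF R] mat_inv_inverse[OF R assms(8)] by blast
  ultimately obtain G where G: "G \<in> carrier_mat (n + n) (n + n)"
    and WG: "W * G = 1\<^sub>m (n + n)" and GW: "G * W = 1\<^sub>m (n + n)"
    using det_nonzero_obtain_inverse[OF W] by (metis mult_eq_0_iff)
  have G_inv: "invertible_mat G" using invertible_mat_if_right_inverse[OF G W GW] .

  obtain G1 G2 G3 G4 where split: "split_block G n n = (G1, G2, G3, G4)"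
    by (metis prod_cases4)
  have G_eq: "G = four_block_mat G1 G2 G3 G4"
    and G1: "G1 \<in> carrier_mat n n" and G2: "G2 \<in> carrier_mat n n"
    and G3: "G3 \<in> carrier_mat n n" and G4: "G4 \<in> carrier_mat n n"
    using split_block[OF split, of n n] G by auto
  note sym = blocks_of_inverse[OF P B Ph assms(4) W_def G1 G2 G3 G4 G_eq WG GW]

  define c where "c = complex_of_real (2 * \<alpha>)"
  define E where "E = 1\<^sub>m n + c \<cdot>\<^sub>m G1"
  define F where "F = c \<cdot>\<^sub>m G3"
  have E: "E \<in> carrier_mat n n" and F: "F \<in> carrier_mat n n"
    unfolding E_def F_def using G1 G3 by auto
  have Eh: "mat_adjoint E = E"
  proof (rule eq_matI)
    fix i j assume ij: "i < dim_row E" "j < dim_col E"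
    then have "mat_adjoint G1 $$ (i, j) = G1 $$ (i, j)" using sym(3) by simp
    with ij show "mat_adjoint E $$ (i, j) = E $$ (i, j)"
      using G1 E unfolding mat_adjoint_conv E_def c_def by auto
  qed (use E in \<open>auto simp: mat_adjoint_conv\<close>)
  have Fs: "transpose_mat F = F"
  proof (rule eq_matI)
    fix i j assume ij: "i < dim_row F" "j < dim_col F"
    then have "transpose_mat G3 $$ (i, j) = G3 $$ (i, j)" using sym(4) by simp
    with ij show "transpose_mat F $$ (i, j) = F $$ (i, j)"
      using G3 F unfolding F_def by auto
  qed (use F in auto)

  \<comment> \<open>\<open>H + \<alpha> I\<close> and \<open>H - \<alpha> I\<close> differ from \<open>W\<close> in one diagonal block each, so multiplying by
    \<open>G = W\<^sup>-\<^sup>1\<close> changes a single block column of the identity.\<close>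
  define D1 where "D1 = four_block_mat (c \<cdot>\<^sub>m 1\<^sub>m n) (0\<^sub>m n n) (0\<^sub>m n n) (0\<^sub>m n n)"
  define D2 where "D2 = four_block_mat (0\<^sub>m n n) (0\<^sub>m n n) (0\<^sub>m n n) (c \<cdot>\<^sub>m 1\<^sub>m n)"
  have D: "D1 \<in> carrier_mat (n + n) (n + n)" "D2 \<in> carrier_mat (n + n) (n + n)"
    unfolding D1_def D2_def by auto
  have "H + complex_of_real \<alpha> \<cdot>\<^sub>m 1\<^sub>m (2 * n) = W + D1"
    unfolding assms(5) W_def D1_def P_def c_def using A B by (intro eq_matI) auto
  then have "G * (H + complex_of_real \<alpha> \<cdot>\<^sub>m 1\<^sub>m (2 * n)) = 1\<^sub>m (n + n) + G * D1"
    using mult_add_distrib_mat[OF G W D(1)] GW by simp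
  also have "G * D1 = four_block_mat (c \<cdot>\<^sub>m G1) (0\<^sub>m n n) (c \<cdot>\<^sub>m G3) (0\<^sub>m n n)"
    unfolding G_eq D1_def using G1 G2 G3 G4
    by (subst mult_four_block_mat[of _ n n _ n _ n _ _ n _ n]) (auto simp: mult_smult_distrib)
  also have "1\<^sub>m (n + n) + \<dots> = four_block_mat E (0\<^sub>m n n) F (1\<^sub>m n)"
    unfolding E_def F_def using G1 G3 by (intro eq_matI) auto
  finally have M: "G * (H + complex_of_real \<alpha> \<cdot>\<^sub>m 1\<^sub>m (2 * n)) =
    four_block_mat E (0\<^sub>m n n) F (1\<^sub>m n)" .
  have "H - complex_of_real \<alpha> \<cdot>\<^sub>m 1\<^sub>m (2 * n) = W - D2"
    unfolding assms(5) W_def D2_def P_def c_def using A B by (intro eq_matI) auto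
  then have "G * (H - complex_of_real \<alpha> \<cdot>\<^sub>m 1\<^sub>m (2 * n)) = 1\<^sub>m (n + n) - G * D2"
    using mult_minus_distrib_mat[OF G W D(2)] GW by simp
  also have "G * D2 = four_block_mat (0\<^sub>m n n) (c \<cdot>\<^sub>m G2) (0\<^sub>m n n) (c \<cdot>\<^sub>m G4)"
    unfolding G_eq D2_def using G1 G2 G3 G4
    by (subst mult_four_block_mat[of _ n n _ n _ n _ _ n _ n]) (auto simp: mult_smult_distrib)
  also have "1\<^sub>m (n + n) - \<dots> = four_block_mat (1\<^sub>m n) (map_mat cnj F) (0\<^sub>m n n) (map_mat cnj E)"
    unfolding E_def F_def c_def sym(1,2) using G1 G3 by (intro eq_matI) auto
  finally have L: "G * (H - complex_of_real \<alpha> \<cdot>\<^sub>m 1\<^sub>m (2 * n)) =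
    four_block_mat (1\<^sub>m n) (map_mat cnj F) (0\<^sub>m n n) (map_mat cnj E)" .

  have Et: "map_mat cnj E = transpose_mat E"
    using Eh unfolding mat_adjoint_conv by (metis map_mat_cnj_cnj)
  have "transpose_mat (map_mat cnj F) = map_mat cnj (transpose_mat F)" by (intro eq_matI) auto
  then have Kt: "transpose_mat (map_mat cnj F) = map_mat cnj F" by (simp add: Fs)
  have "SSF1 n (G * (H + complex_of_real \<alpha> \<cdot>\<^sub>m 1\<^sub>m (2 * n)))
      (G * (H - complex_of_real \<alpha> \<cdot>\<^sub>m 1\<^sub>m (2 * n)))"
    unfolding SSF1_def
    using E F Fs Kt M L Et by (intro exI[of _ E] exI[of _ F] exI[of _ "map_mat cnj F"]) auto
  moreover from this have "symplectic_pair n (G * (H + complex_of_real \<alpha> \<cdot>\<^sub>m 1\<^sub>m (2 * n)))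
      (G * (H - complex_of_real \<alpha> \<cdot>\<^sub>m 1\<^sub>m (2 * n)))"
    by (rule SSF1_symplectic_pair)
  moreover have "G \<in> carrier_mat (2 * n) (2 * n)" using G by (simp add: mult_2)
  ultimately show ?thesis using G_inv E F M L Eh Fs by blast
qed

end
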